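(* Let $(E,\|\cdot\|)$ be a real Banach space that is smooth and strictly convex, let $n\in\mathbb N$ and $r>1$, and let $X$ be a Radon $E$-valued random variable with $\mathbb E\|X\|^r<\infty$ and $\mathrm{card}(\mathrm{supp}\,\mathbb P_X)\ge n$. Then any $L^r$-optimal $n$-quantizer $\alpha$ for $X$ is $L^r$-stationary (and admissible) for $X$. This extends to $r=1$ for any $L^1$-optimal $n$-quantizer $\alpha$ with $\mathbb P_X(\alpha)=0$.
   Context: $X$ is Radon if it is Borel measurable and its distribution $\mathbb P_X$ is a Radon (equivalently tight) probability measure on $E$. $E$ is smooth if the norm is Gateaux-differentiable at every $x\ne0$, with differential $\nabla\|\cdot\|(x)\in E^*$; $E$ is strictly convex if $\|\lambda x+(1-\lambda)y\|<1$ for all $x\ne y$ in the unit sphere and $\lambda\in(0,1)$. An $L^r$-optimal $n$-quantizer for $X$ is a set $\alpha\subset E$ with $1\le\mathrm{card}(\alpha)\le n$ such that $\mathbb E\min_{a\in\alpha}\|X-a\|^r=\inf\{\mathbb E\min_{b\in\beta}\|X-b\|^r:\beta\subset E,\ 1\le\mathrm{card}(\beta)\le n\}$. For $\alpha=\{a_1,\dots,a_n\}\subset E$ of cardinality $n$, let $V_i(\alpha)=\{x\in E:\|x-a_i\|=\min_{1\le k\le n}\|x-a_k\|\}$; a Voronoi partition induced by $\alpha$ is a Borel partition $\{C_i(\alpha):1\le i\le n\}$ of $E$ with $C_i(\alpha)\subset V_i(\alpha)$ for every $i$. $\alpha=\{a_1,\dots,a_n\}$ of cardinality $n$ is admissible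 for $X$ if $\mathbb P_X(V_i(\alpha))>0$ for all $i$ and $\mathbb P_X(V_i(\alpha)\cap V_j(\alpha))=0$ for all $i\ne j$. For $r\ge1$, $\alpha=\{a_1,\dots,a_n\}$ of cardinality $n$ is $L^r$-stationary for $X$ if, for any Voronoi partition $\{C_i(\alpha)\}$ induced by $\alpha$, $\mathbb P_X(C_i(\alpha))>0$ and $$\mathbb E\Big(\mathbf 1_{C_i(\alpha)\setminus\{a_i\}}(X)\,\|X-a_i\|^{r-1}\,\nabla\|\cdot\|(a_i-X)\Big)=0,\qquad i=1,\dots,n$$ (where $\nabla\|\cdot\|(a_i-x)$ is required to be defined for $\mathbb P_X$-a.e. $x\in C_i(\alpha)\setminus\{a_i\}$ and, when $r=1$, it is required in addition that $\mathbb P(X\in\alpha)=0$). The expectation is an element of $E^*$, acting on $u\in E$ as the expectation of the scalar random variable obtained by applying the integrand to $u$. *)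

theory Defs
  imports "HOL-Probability.Probability"
begin

definition has_gateaux_differential ::
    "('a::real_normed_vector \<Rightarrow> real) \<Rightarrow> ('a \<Rightarrow>\<^sub>L real) \<Rightarrow> 'a \<Rightarrow> bool"
  where "has_gateaux_differential f D x \<longleftrightarrow>
    (\<forall>u. ((\<lambda>t. (f (x + t *\<^sub>R u) - f x) / t) \<longlongrightarrow> blinfun_apply D u) (at (0::real)))"

definition gateaux_differentiable :: "('a::real_normed_vector \<Rightarrow> real) \<Rightarrow> 'a \<Rightarrow> bool"
  where "gateaux_differentiable f x \<longleftrightarrow> (\<exists>D. has_gateaux_differential f D x)"

(* The differential is unique when it exists; otherwise the value is unspecified. *)
definition gateaux_differential ::
    "('a::real_normed_vector \<Rightarrow> real) \<Rightarrow> 'a \<Rightarrow> ('a \<Rightarrow>\<^sub>L real)"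
  where "gateaux_differential f x = (THE D. has_gateaux_differential f D x)"

definition smooth_space :: "'a::real_normed_vector itself \<Rightarrow> bool"
  where "smooth_space _ \<longleftrightarrow> (\<forall>x::'a. x \<noteq> 0 \<longrightarrow> gateaux_differentiable norm x)"

definition strictly_convex_space :: "'a::real_normed_vector itself \<Rightarrow> bool"
  where "strictly_convex_space _ \<longleftrightarrow>
    (\<forall>(x::'a) y. \<forall>l::real. norm x = 1 \<longrightarrow> norm y = 1 \<longrightarrow> x \<noteq> y \<longrightarrow> 0 < l \<longrightarrow> l < 1 \<longrightarrow>
       norm (l *\<^sub>R x + (1 - l) *\<^sub>R y) < 1)"

(* Inner regularity of a Borel probability measure with respect to compact sets. *)
definition radon_prob :: "'a::t2_space measure \<Rightarrow> bool"
  where "radon_prob \<mu> \<longleftrightarrow> prob_space \<mu> \<and> sets \<mu> = sets borel \<and>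
    (\<forall>B\<in>sets borel. \<forall>e>0. \<exists>K. compact K \<and> K \<subseteq> B \<and> measure \<mu> B < measure \<mu> K + e)"

definition radon_rv :: "'w measure \<Rightarrow> ('w \<Rightarrow> 'a::t2_space) \<Rightarrow> bool"
  where "radon_rv M X \<longleftrightarrow> X \<in> borel_measurable M \<and> radon_prob (distr M borel X)"

definition msupport :: "'a::topological_space measure \<Rightarrow> 'a set"
  where "msupport \<mu> = {x. \<forall>U. open U \<longrightarrow> x \<in> U \<longrightarrow> measure \<mu> U > 0}"

definition quantizers :: "nat \<Rightarrow> 'a set set"
  where "quantizers n = {\<beta>. finite \<beta> \<and> 1 \<le> card \<beta> \<and> card \<beta> \<le> n}"

definition quant_error ::
    "'w measure \<Rightarrow> ('w \<Rightarrow> 'a::real_normed_vector) \<Rightarrow> real \<Rightarrow> 'a set \<Rightarrow> ennreal"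
  where "quant_error M X r \<alpha> = (\<integral>\<^sup>+w. ennreal (MIN a\<in>\<alpha>. norm (X w - a) powr r) \<partial>M)"

definition optimal_quantizer ::
    "'w measure \<Rightarrow> ('w \<Rightarrow> 'a::real_normed_vector) \<Rightarrow> real \<Rightarrow> nat \<Rightarrow> 'a set \<Rightarrow> bool"
  where "optimal_quantizer M X r n \<alpha> \<longleftrightarrow> \<alpha> \<in> quantizers n \<and>
    quant_error M X r \<alpha> = (INF \<beta>\<in>quantizers n. quant_error M X r \<beta>)"

(* Cells are indexed by the points of \<alpha> themselves rather than by an enumeration of \<alpha>. *)
definition voronoi_cell :: "'a::real_normed_vector set \<Rightarrow> 'a \<Rightarrow> 'a set"
  where "voronoi_cell \<alpha> a = {x. norm (x - a) = (MIN b\<in>\<alpha>. norm (x - b))}"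

definition voronoi_partition :: "'a::real_normed_vector set \<Rightarrow> ('a \<Rightarrow> 'a set) \<Rightarrow> bool"
  where "voronoi_partition \<alpha> C \<longleftrightarrow>
    (\<forall>a\<in>\<alpha>. C a \<in> sets borel \<and> C a \<subseteq> voronoi_cell \<alpha> a) \<and>
    disjoint_family_on C \<alpha> \<and> (\<Union>a\<in>\<alpha>. C a) = UNIV"

definition admissible ::
    "'w measure \<Rightarrow> ('w \<Rightarrow> 'a::real_normed_vector) \<Rightarrow> nat \<Rightarrow> 'a set \<Rightarrow> bool"
  where "admissible M X n \<alpha> \<longleftrightarrow> finite \<alpha> \<and> card \<alpha> = n \<and>
    (\<forall>a\<in>\<alpha>. measure (distr M borel X) (voronoi_cell \<alpha> a) > 0) \<and>
    (\<forall>a\<in>\<alpha>. \<forall>b\<in>\<alpha>. a \<noteq> b \<longrightarrow>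
       measure (distr M borel X) (voronoi_cell \<alpha> a \<inter> voronoi_cell \<alpha> b) = 0)"

(* Expectation of a dual-space-valued variable in the weak-star sense; integrability of
   every scalar variable is part of the predicate. *)
definition has_weak_expectation ::
    "'w measure \<Rightarrow> ('w \<Rightarrow> ('a::real_normed_vector \<Rightarrow>\<^sub>L real)) \<Rightarrow> ('a \<Rightarrow>\<^sub>L real) \<Rightarrow> bool"
  where "has_weak_expectation M Z \<phi> \<longleftrightarrow>
    (\<forall>u. has_bochner_integral M (\<lambda>w. blinfun_apply (Z w) u) (blinfun_apply \<phi> u))"

(* At r = 1 the factor norm (X w - a) powr 0 equals 1 wherever the indicator is nonzero. *)
definition stationary ::
    "'w measure \<Rightarrow> ('w \<Rightarrow> 'a::real_normed_vector) \<Rightarrow> real \<Rightarrow> nat \<Rightarrow> 'a set \<Rightarrow> bool"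
  where "stationary M X r n \<alpha> \<longleftrightarrow> finite \<alpha> \<and> card \<alpha> = n \<and>
    (r = 1 \<longrightarrow> measure (distr M borel X) \<alpha> = 0) \<and>
    (\<forall>C. voronoi_partition \<alpha> C \<longrightarrow> (\<forall>a\<in>\<alpha>.
       measure (distr M borel X) (C a) > 0 \<and>
       (AE x in distr M borel X. x \<in> C a - {a} \<longrightarrow> gateaux_differentiable norm (a - x)) \<and>
       has_weak_expectation M
         (\<lambda>w. (indicator (C a - {a}) (X w) * norm (X w - a) powr (r - 1))
                *\<^sub>R gateaux_differential norm (a - X w)) 0))"

end

theory Submission
  imports Defs
begin

text \<open>
  Everything takes place on the distribution \<open>\<mu>\<close> of \<open>X\<close>, with the loss
  \<open>quant_loss r \<alpha> x\<close>, the smallest \<open>r\<close>-th power of a distance from \<open>x\<close> to a point of \<open>\<alpha>\<close>.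

  Full cardinality and positive mass of the cells. Adding a point of the support of \<open>\<mu>\<close> to a
  finite set that misses it strictly lowers the expected loss (\<open>integral_quant_loss_insert_less\<close>),
  so an optimal \<open>\<alpha>\<close> is strictly better than every set with fewer than \<open>n\<close> points. A point
  whose cell has mass zero could be deleted from \<open>\<alpha>\<close> at no cost, so there is none
  (\<open>optimal_cell_not_null\<close>).

  Stationarity. Let \<open>S\<close> be the cell chosen for \<open>a\<close>. Move \<open>a\<close> to \<open>a + t u\<close> but go on serving
  the points of \<open>S\<close> from the moved centre and all others from their old ones. The resulting cost is
  an upper bound for the loss of the moved quantizer, hence by optimality the integral over \<open>S\<close> of
  \<open>norm (x - a - t u) powr r - norm (x - a) powr r\<close> is nonnegative (\<open>optimal_perturbation\<close>).
  Freezing the assignment removes the dependence of the cells on \<open>t\<close>. Divide by \<open>t\<close> and let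
  \<open>t\<close> decrease to 0: the quotients are dominated because \<open>norm x powr r\<close> is convex, and the limit is
  \<open>r\<close> times the integral of the stationarity integrand in direction \<open>u\<close>. So this integral is
  nonnegative for \<open>u\<close> and for \<open>- u\<close>, and it is linear in \<open>u\<close>; it vanishes
  (\<open>optimal_first_order_condition\<close>).

  Overlaps of cells. The first-order condition holds whether the points equidistant from \<open>a\<close> and \<open>b\<close>
  are given to \<open>a\<close> or withheld from it. Subtracting the two versions leaves an integral over the
  overlap of the two cells that vanishes. In direction \<open>b - a\<close> its integrand is strictly negative there,
  because by strict convexity the midpoint of \<open>a\<close> and \<open>b\<close> is closer to \<open>x\<close> than
  both ends; so the overlap is null (\<open>optimal_cell_overlap_null\<close>).
\<close>

section \<open>Convexity and differentiability of powers of the norm\<close>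

lemma powr_convex_combination:
  fixes x y s r :: real
  assumes "1 \<le> r" "0 \<le> x" "0 \<le> y" "0 \<le> s" "s \<le> 1"
  shows "((1 - s) * x + s * y) powr r \<le> (1 - s) * x powr r + s * y powr r"
proof -
  have shrink: "(c * z) powr r \<le> c * z powr r" if "0 \<le> c" "c \<le> 1" "0 \<le> z" for c z :: real
  proof -
    have "c powr r \<le> c"
      using powr_mono'[of 1 r c] that assms(1) by (cases "c = 0") auto
    then show ?thesis
      using that by (simp add: powr_mult mult_right_mono)
  qed
  consider "x = 0" | "y = 0" | "0 < x" "0 < y" using assms by linarith
  then show ?thesis
  proof cases
    case 1 then show ?thesis using shrink[of s y] assms by simp
  next
    case 2 then show ?thesis using shrink[of "1 - s" x] assms by simp
  next
    case 3
    then show ?thesis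
      using convex_onD[OF powr_convex[OF assms(1)], of s x y] assms by simp
  qed
qed

lemma norm_powr_convex_combination:
  fixes v w :: "'a::real_normed_vector"
  assumes "1 \<le> r" "0 \<le> s" "s \<le> 1"
  shows "norm ((1 - s) *\<^sub>R v + s *\<^sub>R w) powr r \<le> (1 - s) * norm v powr r + s * norm w powr r"
proof -
  have "norm ((1 - s) *\<^sub>R v + s *\<^sub>R w) \<le> (1 - s) * norm v + s * norm w"
    using norm_triangle_ineq[of "(1 - s) *\<^sub>R v" "s *\<^sub>R w"] assms by simp
  then have "norm ((1 - s) *\<^sub>R v + s *\<^sub>R w) powr r \<le> ((1 - s) * norm v + s * norm w) powr r"
    using assms by (intro powr_mono2) auto
  also have "\<dots> \<le> (1 - s) * norm v powr r + s * norm w powr r"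
    using assms by (intro powr_convex_combination) auto
  finally show ?thesis .
qed

text \<open>
  The bound is uniform in \<open>t\<close>, which makes it the dominating function below. It comes from
  the monotonicity of slopes of the convex function \<open>t \<mapsto> norm (v + t u) powr r\<close>: the slope over
  \<open>[0, t]\<close> lies between those over \<open>[-1, 0]\<close> and \<open>[0, 1]\<close>.
\<close>

lemma norm_powr_difference_quotient_bound:
  fixes v u :: "'a::real_normed_vector"
  assumes "1 \<le> r" "0 < t" "t \<le> 1"
  shows "\<bar>(norm (v + t *\<^sub>R u) powr r - norm v powr r) / t\<bar>
      \<le> norm (v + u) powr r + norm (v - u) powr r + norm v powr r"
proof -
  let ?p = "\<lambda>s. norm (v + s *\<^sub>R u) powr r"
  have "(1 - t) *\<^sub>R v + t *\<^sub>R (v + u) = v + t *\<^sub>R u"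
    by (simp add: algebra_simps)
  then have "?p t \<le> (1 - t) * ?p 0 + t * ?p 1"
    using norm_powr_convex_combination[OF assms(1), of t v "v + u"] assms by simp
  then have upper: "(?p t - ?p 0) / t \<le> ?p 1 - ?p 0"
    using assms by (simp add: field_simps)
  \<comment> \<open>the weight for which \<open>v\<close> is a convex combination of \<open>v + t u\<close> and \<open>v - u\<close>\<close>
  define s where "s = t / (1 + t)"
  have s: "0 \<le> s" "s \<le> 1" "1 - s = 1 / (1 + t)"
    using assms by (auto simp: s_def field_simps)
  have "(1 - s) *\<^sub>R (v + t *\<^sub>R u) + s *\<^sub>R (v - u) = ((1 - s) + s) *\<^sub>R v + ((1 - s) * t - s) *\<^sub>R u"
    by (simp add: algebra_simps)
  also have "(1 - s) * t - s = 0"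
    unfolding s(3) by (simp add: s_def)
  finally have "norm v powr r \<le> (1 - s) * ?p t + s * norm (v - u) powr r"
    using norm_powr_convex_combination[OF assms(1) s(1,2), of "v + t *\<^sub>R u" "v - u"] by simp
  then have "norm v powr r \<le> (?p t + t * norm (v - u) powr r) / (1 + t)"
    unfolding s(3) by (simp add: s_def add_divide_distrib)
  then have lower: "?p 0 - norm (v - u) powr r \<le> (?p t - ?p 0) / t"
    using assms by (simp add: field_simps)
  have nonneg: "0 \<le> ?p 1" "0 \<le> ?p 0" "0 \<le> norm (v - u) powr r" by auto
  have "\<bar>(?p t - ?p 0) / t\<bar> \<le> ?p 1 + norm (v - u) powr r + ?p 0"
    using upper lower nonneg by linarith
  then show ?thesis by simp
qed

lemma norm_powr_difference_quotient_tendsto: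
  fixes v u :: "'a::real_normed_vector"
  assumes D: "has_gateaux_differential norm D v" and "v \<noteq> 0"
  shows "((\<lambda>t. (norm (v + t *\<^sub>R u) powr r - norm v powr r) / t)
      \<longlongrightarrow> r * norm v powr (r - 1) * blinfun_apply D u) (at 0)"
proof -
  have "((\<lambda>t. norm (v + t *\<^sub>R u)) has_real_derivative blinfun_apply D u) (at 0)"
    using D unfolding has_gateaux_differential_def DERIV_def by simp
  from DERIV_fun_powr[OF this, of r] assms(2) show ?thesis
    unfolding DERIV_def by simp
qed

text \<open>
  At the origin the norm has no differential, but its \<open>r\<close>-th power for \<open>r > 1\<close> has differential 0.
  This is why atoms of the distribution on the quantizer are harmless unless \<open>r = 1\<close>.
\<close>

lemma norm_powr_difference_quotient_tendsto_0:
  fixes u :: "'a::real_normed_vector"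
  assumes "1 < r"
  shows "((\<lambda>t. norm (t *\<^sub>R u) powr r / t) \<longlongrightarrow> 0) (at_right 0)"
proof -
  have "((\<lambda>t::real. t powr (r - 1)) \<longlongrightarrow> 0) (at_right 0)"
    using assms eventually_at_right_less[of "0::real"]
    by (intro tendsto_zero_powrI tendsto_ident_at tendsto_const) (auto elim: eventually_mono)
  from tendsto_mult_right[OF this, of "norm u powr r"] have "((\<lambda>t. t powr (r - 1) * norm u powr r) \<longlongrightarrow> 0) (at_right 0)"
    by simp
  then show ?thesis
  proof (rule Lim_transform_eventually)
    show "\<forall>\<^sub>F t in at_right 0. t powr (r - 1) * norm u powr r = norm (t *\<^sub>R u) powr r / t"
      using eventually_at_right_less[of 0]
      by eventually_elim (simp add: powr_mult powr_diff)
  qed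
qed

lemma gateaux_differential_eqI:
  assumes "has_gateaux_differential f D x"
  shows "gateaux_differential f x = D"
  unfolding gateaux_differential_def
proof (rule the_equality)
  fix D' assume "has_gateaux_differential f D' x"
  with assms show "D' = D"
    unfolding has_gateaux_differential_def by (intro blinfun_eqI) (metis LIM_unique)
qed (fact assms)

lemma smooth_space_gateaux_differential:
  assumes "smooth_space TYPE('a::real_normed_vector)" "(v::'a) \<noteq> 0"
  shows "has_gateaux_differential norm (gateaux_differential norm v) v"
  using assms gateaux_differential_eqI
  unfolding smooth_space_def gateaux_differentiable_def by metis

lemma strictly_convex_midpoint:
  fixes v w :: "'a::real_normed_vector"
  assumes sc: "strictly_convex_space TYPE('a)" and "norm v = norm w" "v \<noteq> w"
  shows "norm ((1/2) *\<^sub>R (v + w)) < norm v"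
proof -
  let ?\<rho> = "norm v"
  have pos: "0 < ?\<rho>" using assms by auto
  let ?v = "(1 / ?\<rho>) *\<^sub>R v" and ?w = "(1 / ?\<rho>) *\<^sub>R w"
  have "norm ?v = 1" "norm ?w = 1" "?v \<noteq> ?w" using pos assms by auto
  then have "norm ((1/2) *\<^sub>R ?v + (1 - 1/2) *\<^sub>R ?w) < 1"
    using sc[unfolded strictly_convex_space_def, rule_format, of ?v ?w "1/2"] by linarith
  moreover have "(1/2) *\<^sub>R ?v + (1 - 1/2) *\<^sub>R ?w = (1 / ?\<rho>) *\<^sub>R ((1/2) *\<^sub>R (v + w))"
    by (simp add: algebra_simps)
  ultimately have "\<bar>1 / ?\<rho>\<bar> * norm ((1/2) *\<^sub>R (v + w)) < 1"
    by (metis norm_scaleR)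
  then show ?thesis using pos by (simp add: field_simps)
qed

text \<open>
  Moving from \<open>v\<close> straight towards another point \<open>w\<close> of the same sphere, one first reaches the
  midpoint, where the norm is strictly smaller; by convexity the slope up to the midpoint bounds the
  initial slope from above.
\<close>

lemma gateaux_differential_strictly_convex_neg:
  fixes v w :: "'a::real_normed_vector"
  assumes sc: "strictly_convex_space TYPE('a)" and D: "has_gateaux_differential norm D v"
    and "norm v = norm w" "v \<noteq> w"
  shows "blinfun_apply D (w - v) < 0"
proof -
  let ?m = "norm ((1/2) *\<^sub>R (v + w))"
  have lim: "((\<lambda>t. (norm (v + t *\<^sub>R (w - v)) - norm v) / t) \<longlongrightarrow> blinfun_apply D (w - v)) (at_right 0)"
    using D unfolding has_gateaux_differential_def by (meson filterlim_at_split)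
  have "\<forall>\<^sub>F t in at_right 0. (norm (v + t *\<^sub>R (w - v)) - norm v) / t \<le> 2 * (?m - norm v)"
    unfolding eventually_at_right_field
  proof (intro exI[of _ "1/2"] conjI allI impI)
    fix t :: real assume t: "0 < t" "t < 1/2"
    have "v + t *\<^sub>R (w - v) = (1 - 2 * t) *\<^sub>R v + (2 * t) *\<^sub>R ((1/2) *\<^sub>R (v + w))"
      by (simp add: algebra_simps flip: scaleR_add_left)
    then have "norm (v + t *\<^sub>R (w - v)) \<le> (1 - 2 * t) * norm v + 2 * t * ?m"
      using norm_triangle_ineq[of "(1 - 2 * t) *\<^sub>R v" "(2 * t) *\<^sub>R ((1/2) *\<^sub>R (v + w))"] t by simp
    then show "(norm (v + t *\<^sub>R (w - v)) - norm v) / t \<le> 2 * (?m - norm v)"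
      using t by (simp add: field_simps)
  qed simp
  then have "blinfun_apply D (w - v) \<le> 2 * (?m - norm v)"
    by (intro tendsto_upperbound[OF lim]) auto
  also have "\<dots> < 0"
    by (intro mult_pos_neg) (use strictly_convex_midpoint[OF sc assms(3,4)] in simp_all)
  finally show ?thesis .
qed

section \<open>Quantization of a distribution with finite moment\<close>

definition quant_loss :: "real \<Rightarrow> 'a::real_normed_vector set \<Rightarrow> 'a \<Rightarrow> real"
  where "quant_loss r \<alpha> x = (MIN a\<in>\<alpha>. norm (x - a) powr r)"

lemma quant_loss_le: "finite \<alpha> \<Longrightarrow> a \<in> \<alpha> \<Longrightarrow> quant_loss r \<alpha> x \<le> norm (x - a) powr r"
  unfolding quant_loss_def by (intro Min_le) auto

lemma quant_loss_attained:
  assumes "finite \<alpha>" "\<alpha> \<noteq> {}"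
  obtains a where "a \<in> \<alpha>" "quant_loss r \<alpha> x = norm (x - a) powr r"
proof -
  have "(MIN a\<in>\<alpha>. norm (x - a) powr r) \<in> (\<lambda>a. norm (x - a) powr r) ` \<alpha>"
    using assms by (intro Min_in) auto
  then show thesis
    using that unfolding quant_loss_def by blast
qed

lemma quant_loss_antimono:
  assumes "finite \<beta>" "\<alpha> \<subseteq> \<beta>" "\<alpha> \<noteq> {}"
  shows "quant_loss r \<beta> x \<le> quant_loss r \<alpha> x"
  using assms unfolding quant_loss_def by (intro Min_antimono) auto

lemma voronoi_cell_iff:
  assumes "finite \<alpha>" "a \<in> \<alpha>"
  shows "x \<in> voronoi_cell \<alpha> a \<longleftrightarrow> (\<forall>b\<in>\<alpha>. norm (x - a) \<le> norm (x - b))"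
proof
  assume "x \<in> voronoi_cell \<alpha> a"
  then show "\<forall>b\<in>\<alpha>. norm (x - a) \<le> norm (x - b)"
    using assms by (auto simp: voronoi_cell_def)
next
  assume "\<forall>b\<in>\<alpha>. norm (x - a) \<le> norm (x - b)"
  then have "(MIN b\<in>\<alpha>. norm (x - b)) = norm (x - a)"
    using assms by (intro Min_eqI) auto
  then show "x \<in> voronoi_cell \<alpha> a"
    by (simp add: voronoi_cell_def)
qed

lemma quant_loss_on_voronoi_cell:
  assumes "finite \<alpha>" "a \<in> \<alpha>" "x \<in> voronoi_cell \<alpha> a" "0 \<le> r"
  shows "quant_loss r \<alpha> x = norm (x - a) powr r"
  unfolding quant_loss_def
  using assms voronoi_cell_iff[OF assms(1,2)] by (intro Min_eqI) (auto intro!: powr_mono2)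

lemma in_some_voronoi_cell:
  assumes "finite \<alpha>" "\<alpha> \<noteq> {}"
  obtains a where "a \<in> \<alpha>" "x \<in> voronoi_cell \<alpha> a"
proof -
  have "(MIN b\<in>\<alpha>. norm (x - b)) \<in> (\<lambda>b. norm (x - b)) ` \<alpha>"
    using assms by (intro Min_in) auto
  then obtain a where "a \<in> \<alpha>" "(MIN b\<in>\<alpha>. norm (x - b)) = norm (x - a)"
    by blast
  then show thesis
    using that by (simp add: voronoi_cell_def)
qed

lemma closed_voronoi_cell:
  assumes "finite \<alpha>" "a \<in> \<alpha>"
  shows "closed (voronoi_cell \<alpha> a)"
proof -
  have "voronoi_cell \<alpha> a = (\<Inter>b\<in>\<alpha>. {x. norm (x - a) \<le> norm (x - b)})"
    using voronoi_cell_iff[OF assms] by auto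
  also have "closed \<dots>"
    by (intro closed_INT ballI closed_Collect_le continuous_intros)
  finally show ?thesis .
qed

text \<open>
  The sets that occur as the member belonging to \<open>a\<close> of some Voronoi partition: the points outside
  \<open>S\<close> can be assigned to other centres. Asking for this directly avoids building partitions of the
  whole space in order to vary a single cell.
\<close>
definition selectable_cell :: "'a::real_normed_vector set \<Rightarrow> 'a \<Rightarrow> 'a set \<Rightarrow> bool"
  where "selectable_cell \<alpha> a S \<longleftrightarrow> S \<in> sets borel \<and> S \<subseteq> voronoi_cell \<alpha> a \<and>
    (\<forall>x. x \<notin> S \<longrightarrow> (\<exists>b\<in>\<alpha> - {a}. x \<in> voronoi_cell \<alpha> b))"

lemma selectable_cell_voronoi_partition:
  assumes "voronoi_partition \<alpha> C" "a \<in> \<alpha>"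
  shows "selectable_cell \<alpha> a (C a)"
  using assms unfolding voronoi_partition_def selectable_cell_def by blast

lemma selectable_cell_voronoi_cell:
  assumes "finite \<alpha>" "a \<in> \<alpha>"
  shows "selectable_cell \<alpha> a (voronoi_cell \<alpha> a)"
  unfolding selectable_cell_def
proof (intro conjI allI impI)
  fix x assume "x \<notin> voronoi_cell \<alpha> a"
  then show "\<exists>b\<in>\<alpha> - {a}. x \<in> voronoi_cell \<alpha> b"
    using in_some_voronoi_cell[OF assms(1), of x] assms(2) by blast
qed (use closed_voronoi_cell[OF assms] in auto)

lemma selectable_cell_minus:
  assumes "finite \<alpha>" "a \<in> \<alpha>" "b \<in> \<alpha>" "a \<noteq> b"
  shows "selectable_cell \<alpha> a (voronoi_cell \<alpha> a - voronoi_cell \<alpha> b)"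
  using selectable_cell_voronoi_cell[OF assms(1,2)] closed_voronoi_cell[OF assms(1,3)] assms(3,4)
  unfolding selectable_cell_def by auto

locale finite_moment_distribution = prob_space \<mu>
  for \<mu> :: "'a::real_normed_vector measure" +
  fixes r :: real
  assumes sets_eq_borel [measurable_cong]: "sets \<mu> = sets borel"
    and r_ge_1: "1 \<le> r"
    and integrable_norm_powr: "integrable \<mu> (\<lambda>x. norm x powr r)"
begin

text \<open>
  On a nonseparable space the difference of two Borel measurable maps need not be Borel measurable, so
  measurability is obtained from continuity of the whole map.
\<close>

lemma measurable_norm_diff [measurable]: "(\<lambda>x. norm (x - a)) \<in> borel_measurable \<mu>"
  unfolding measurable_cong_sets[OF sets_eq_borel refl]
  by (intro borel_measurable_continuous_onI continuous_intros)

lemma integrable_norm_diff_powr: "integrable \<mu> (\<lambda>x. norm (x - a) powr r)"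
proof (rule Bochner_Integration.integrable_bound)
  show "integrable \<mu> (\<lambda>x. 2 powr r * norm x powr r + norm (2 *\<^sub>R a) powr r)"
    using integrable_norm_powr by simp
  show "AE x in \<mu>. norm (norm (x - a) powr r) \<le> norm (2 powr r * norm x powr r + norm (2 *\<^sub>R a) powr r)"
  proof (rule AE_I2)
    fix x
    have "x - a = (1 - 1/2) *\<^sub>R (2 *\<^sub>R x) + (1/2) *\<^sub>R (- (2 *\<^sub>R a))" by simp
    then have "norm (x - a) powr r \<le> (1 - 1/2) * norm (2 *\<^sub>R x) powr r + (1/2) * norm (- (2 *\<^sub>R a)) powr r"
      using norm_powr_convex_combination[OF r_ge_1, of "1/2" "2 *\<^sub>R x" "- (2 *\<^sub>R a)"] by simp
    also have "\<dots> \<le> norm (2 *\<^sub>R x) powr r + norm (2 *\<^sub>R a) powr r"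
      unfolding norm_minus_cancel by (intro add_mono mult_left_le_one_le) auto
    also have "norm (2 *\<^sub>R x) powr r = 2 powr r * norm x powr r"
      by (simp add: powr_mult)
    finally show "norm (norm (x - a) powr r) \<le> norm (2 powr r * norm x powr r + norm (2 *\<^sub>R a) powr r)"
      by simp
  qed
qed simp

lemma measurable_quant_loss [measurable]: "finite \<alpha> \<Longrightarrow> quant_loss r \<alpha> \<in> borel_measurable \<mu>"
  unfolding quant_loss_def by measurable

lemma integrable_quant_loss:
  assumes "finite \<alpha>" "\<alpha> \<noteq> {}"
  shows "integrable \<mu> (quant_loss r \<alpha>)"
proof -
  obtain a where a: "a \<in> \<alpha>" using assms by auto
  show ?thesis
  proof (rule Bochner_Integration.integrable_bound[OF integrable_norm_diff_powr[of a]])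
    show "AE x in \<mu>. norm (quant_loss r \<alpha> x) \<le> norm (norm (x - a) powr r)"
    proof (rule AE_I2)
      fix x
      have "0 \<le> quant_loss r \<alpha> x"
        by (rule quant_loss_attained[OF assms, of r x]) simp
      then show "norm (quant_loss r \<alpha> x) \<le> norm (norm (x - a) powr r)"
        using quant_loss_le[OF assms(1) a] by simp
    qed
  qed (use assms in measurable)
qed

definition optimal :: "nat \<Rightarrow> 'a set \<Rightarrow> bool"
  where "optimal n \<alpha> \<longleftrightarrow> \<alpha> \<in> quantizers n \<and>
    (\<forall>\<beta>\<in>quantizers n. (\<integral>x. quant_loss r \<alpha> x \<partial>\<mu>) \<le> (\<integral>x. quant_loss r \<beta> x \<partial>\<mu>))"

lemma optimal_finite: "optimal n \<alpha> \<Longrightarrow> finite \<alpha>" "optimal n \<alpha> \<Longrightarrow> \<alpha> \<noteq> {}"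
  by (auto simp: optimal_def quantizers_def)

text \<open>
  If a ball around \<open>x0\<close> misses \<open>\<beta>\<close>, then on the ball of half its radius the new point is strictly
  closer than every old one, and this smaller ball has positive mass.
\<close>

lemma integral_quant_loss_insert_less:
  assumes "finite \<beta>" "\<beta> \<noteq> {}" "x0 \<in> msupport \<mu>" "x0 \<notin> \<beta>"
  shows "(\<integral>x. quant_loss r (insert x0 \<beta>) x \<partial>\<mu>) < (\<integral>x. quant_loss r \<beta> x \<partial>\<mu>)"
proof -
  have "open (- \<beta>)" using finite_imp_closed[OF assms(1)] by auto
  then obtain e where e: "0 < e" "ball x0 e \<subseteq> - \<beta>"
    using assms(4) by (metis ComplI open_contains_ball)
  show ?thesis
  proof (rule integral_less_AE)
    show "integrable \<mu> (quant_loss r (insert x0 \<beta>))" "integrable \<mu> (quant_loss r \<beta>)"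
      using assms by (auto intro!: integrable_quant_loss)
    have "measure \<mu> (ball x0 (e/2)) > 0"
      using assms(3) e by (auto simp: msupport_def)
    then show "emeasure \<mu> (ball x0 (e/2)) \<noteq> 0"
      by (auto simp: emeasure_eq_measure)
    show "ball x0 (e/2) \<in> sets \<mu>" by (simp add: sets_eq_borel)
    show "AE x in \<mu>. quant_loss r (insert x0 \<beta>) x \<le> quant_loss r \<beta> x"
      using assms by (intro AE_I2 quant_loss_antimono) auto
    show "AE x in \<mu>. x \<in> ball x0 (e/2) \<longrightarrow> quant_loss r (insert x0 \<beta>) x \<noteq> quant_loss r \<beta> x"
    proof (intro AE_I2 impI)
      fix x assume x: "x \<in> ball x0 (e/2)"
      obtain b where b: "b \<in> \<beta>" "quant_loss r \<beta> x = norm (x - b) powr r"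
        using quant_loss_attained[OF assms(1,2)] by blast
      have "e \<le> dist x0 b" using e b by force
      then have "norm (x - x0) < norm (x - b)"
        using x dist_triangle[of x0 b x] by (auto simp: dist_norm norm_minus_commute)
      then have "norm (x - x0) powr r < norm (x - b) powr r"
        using r_ge_1 by (intro powr_less_mono2) auto
      then show "quant_loss r (insert x0 \<beta>) x \<noteq> quant_loss r \<beta> x"
        using quant_loss_le[of "insert x0 \<beta>" x0 r x] assms(1) b by simp
    qed
  qed
qed

lemma optimal_less_than_smaller:
  assumes opt: "optimal n \<alpha>" and "finite \<beta>" "\<beta> \<noteq> {}" "card \<beta> < n"
    and supp: "finite (msupport \<mu>) \<longrightarrow> n \<le> card (msupport \<mu>)"
  shows "(\<integral>x. quant_loss r \<alpha> x \<partial>\<mu>) < (\<integral>x. quant_loss r \<beta> x \<partial>\<mu>)"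
proof -
  \<comment> \<open>the support has at least \<open>n\<close> points, so \<open>\<beta>\<close> misses one of them\<close>
  have "\<not> msupport \<mu> \<subseteq> \<beta>"
    using assms by (meson card_mono finite_subset le_trans not_le)
  then obtain x0 where x0: "x0 \<in> msupport \<mu>" "x0 \<notin> \<beta>" by auto
  have "insert x0 \<beta> \<in> quantizers n"
    using assms x0 by (auto simp: quantizers_def)
  then have "(\<integral>x. quant_loss r \<alpha> x \<partial>\<mu>) \<le> (\<integral>x. quant_loss r (insert x0 \<beta>) x \<partial>\<mu>)"
    using opt by (simp add: optimal_def)
  also have "\<dots> < (\<integral>x. quant_loss r \<beta> x \<partial>\<mu>)"
    using integral_quant_loss_insert_less assms x0 by blast
  finally show ?thesis .
qed

lemma optimal_card:
  assumes "optimal n \<alpha>" "finite (msupport \<mu>) \<longrightarrow> n \<le> card (msupport \<mu>)"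
  shows "card \<alpha> = n"
proof -
  have "card \<alpha> \<le> n" using assms by (auto simp: optimal_def quantizers_def)
  moreover have "\<not> card \<alpha> < n"
    using optimal_less_than_smaller[OF assms(1) optimal_finite[OF assms(1)] _ assms(2)] by auto
  ultimately show ?thesis by simp
qed

lemma optimal_cell_not_null:
  assumes opt: "optimal n \<alpha>" and supp: "finite (msupport \<mu>) \<longrightarrow> n \<le> card (msupport \<mu>)"
    and a: "a \<in> \<alpha>" and S: "selectable_cell \<alpha> a S"
  shows "measure \<mu> S > 0"
proof (rule ccontr)
  assume "\<not> measure \<mu> S > 0"
  then have "measure \<mu> S = 0" by (simp add: measure_le_0_iff not_less)
  moreover have S_sets: "S \<in> sets \<mu>" using S by (simp add: selectable_cell_def sets_eq_borel)
  ultimately have null: "AE x in \<mu>. x \<notin> S"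
    by (intro AE_not_in) (simp add: null_sets_def emeasure_eq_measure)
  note fin = optimal_finite[OF opt]
  let ?\<beta> = "\<alpha> - {a}"
  have ne: "?\<beta> \<noteq> {}"
  proof
    assume "?\<beta> = {}"
    then have "S = UNIV" using S by (auto simp: selectable_cell_def)
    with null show False by simp
  qed
  have "AE x in \<mu>. quant_loss r ?\<beta> x = quant_loss r \<alpha> x"
    using null
  proof eventually_elim
    fix x assume "x \<notin> S"
    then obtain b where b: "b \<in> ?\<beta>" "x \<in> voronoi_cell \<alpha> b"
      using S by (auto simp: selectable_cell_def)
    then have "quant_loss r \<alpha> x = norm (x - b) powr r"
      using quant_loss_on_voronoi_cell[of \<alpha> b x r] fin r_ge_1 by auto
    then have "quant_loss r ?\<beta> x \<le> quant_loss r \<alpha> x"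
      using quant_loss_le[OF _ b(1), of r x] fin by auto
    then show "quant_loss r ?\<beta> x = quant_loss r \<alpha> x"
      using quant_loss_antimono[of \<alpha> ?\<beta> r x] fin ne by auto
  qed
  then have "(\<integral>x. quant_loss r ?\<beta> x \<partial>\<mu>) = (\<integral>x. quant_loss r \<alpha> x \<partial>\<mu>)"
    using fin by (intro integral_cong_AE) auto
  moreover have "card ?\<beta> < n"
    using optimal_card[OF opt supp] card_Diff1_less[OF fin(1) a] by simp
  ultimately show False
    using optimal_less_than_smaller[OF opt _ ne _ supp] fin by auto
qed

section \<open>The first-order condition\<close>

text \<open>
  Replacing \<open>a\<close> by \<open>c\<close> while keeping the old assignment of points to centres (\<open>S\<close> to \<open>c\<close>, the rest
  unchanged) costs at least as much as the quantizer with \<open>c\<close> in place of \<open>a\<close>, hence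
  at least the optimum. The set \<open>S\<close> does not move with \<open>c\<close>.
\<close>

lemma optimal_perturbation:
  assumes opt: "optimal n \<alpha>" and a: "a \<in> \<alpha>" and S: "selectable_cell \<alpha> a S"
  shows "0 \<le> (\<integral>x. indicator S x * (norm (x - c) powr r - norm (x - a) powr r) \<partial>\<mu>)"
proof -
  note fin = optimal_finite[OF opt]
  have [measurable]: "S \<in> sets \<mu>" using S by (simp add: selectable_cell_def sets_eq_borel)
  let ?\<beta> = "insert c (\<alpha> - {a})"
  let ?h = "\<lambda>x. indicator S x * (norm (x - c) powr r - norm (x - a) powr r)"
  have h: "integrable \<mu> ?h"
    using integrable_mult_indicator[of S \<mu> "\<lambda>x. norm (x - c) powr r - norm (x - a) powr r"]
      integrable_norm_diff_powr by simp
  have "card ?\<beta> \<le> card \<alpha>"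
    using fin a card_insert_le_m1[of "card \<alpha>" "\<alpha> - {a}" c] by (simp add: card_gt_0_iff)
  then have "?\<beta> \<in> quantizers n"
    using opt by (auto simp: optimal_def quantizers_def Suc_le_eq card_gt_0_iff)
  then have "(\<integral>x. quant_loss r \<alpha> x \<partial>\<mu>) \<le> (\<integral>x. quant_loss r ?\<beta> x \<partial>\<mu>)"
    using opt by (simp add: optimal_def)
  also have "\<dots> \<le> (\<integral>x. quant_loss r \<alpha> x + ?h x \<partial>\<mu>)"
  proof (rule integral_mono)
    show "integrable \<mu> (quant_loss r ?\<beta>)" using fin by (intro integrable_quant_loss) auto
    show "integrable \<mu> (\<lambda>x. quant_loss r \<alpha> x + ?h x)"
      by (intro Bochner_Integration.integrable_add integrable_quant_loss fin h)
    fix x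
    show "quant_loss r ?\<beta> x \<le> quant_loss r \<alpha> x + ?h x"
    proof (cases "x \<in> S")
      case True
      then have "quant_loss r \<alpha> x = norm (x - a) powr r"
        using quant_loss_on_voronoi_cell[OF fin(1) a, of x r] S r_ge_1 by (auto simp: selectable_cell_def)
      then show ?thesis
        using quant_loss_le[of ?\<beta> c r x] True fin by simp
    next
      case False
      then obtain b where b: "b \<in> \<alpha> - {a}" "x \<in> voronoi_cell \<alpha> b"
        using S by (auto simp: selectable_cell_def)
      then have "quant_loss r \<alpha> x = norm (x - b) powr r"
        using quant_loss_on_voronoi_cell[of \<alpha> b x r] fin r_ge_1 by auto
      then show ?thesis
        using quant_loss_le[of ?\<beta> b r x] False b fin by simp
    qed
  qed
  also have "\<dots> = (\<integral>x. quant_loss r \<alpha> x \<partial>\<mu>) + (\<integral>x. ?h x \<partial>\<mu>)"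
    by (intro Bochner_Integration.integral_add integrable_quant_loss fin h)
  finally show ?thesis by simp
qed

text \<open>
  Up to the factor \<open>r\<close>, the derivative at \<open>t = 0\<close> of \<open>norm (x - (a + t u)) powr r\<close> on \<open>S\<close> away
  from \<open>a\<close>: the stationarity integrand applied to \<open>u\<close>.
\<close>

definition loss_derivative :: "'a \<Rightarrow> 'a set \<Rightarrow> 'a \<Rightarrow> 'a \<Rightarrow> real"
  where "loss_derivative a S u x = indicator (S - {a}) x * norm (x - a) powr (r - 1)
    * blinfun_apply (gateaux_differential norm (a - x)) u"

lemma inverse_Suc_at_right_0: "filterlim (\<lambda>k. inverse (real (Suc k))) (at_right 0) sequentially"
  unfolding filterlim_at using LIMSEQ_inverse_real_of_nat by (auto simp del: of_nat_Suc)

text \<open>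
  The differential is applied to one fixed direction, so it is a pointwise limit of difference
  quotients of the norm, each of which is continuous in \<open>x\<close>.
\<close>

lemma measurable_loss_derivative:
  assumes smooth: "smooth_space TYPE('a)" and [measurable]: "S \<in> sets \<mu>"
  shows "loss_derivative a S u \<in> borel_measurable \<mu>"
proof -
  let ?q = "\<lambda>k x. (norm (x - (a + inverse (real (Suc k)) *\<^sub>R u)) - norm (x - a)) / inverse (real (Suc k))"
  have [measurable]: "{a} \<in> sets \<mu>" by (simp add: sets_eq_borel)
  have directional: "(\<lambda>x. indicator (S - {a}) x * blinfun_apply (gateaux_differential norm (a - x)) u)
      \<in> borel_measurable \<mu>"
  proof (rule borel_measurable_LIMSEQ_real)
    fix x
    show "(\<lambda>k. indicator (S - {a}) x * ?q k x)
        \<longlonglongrightarrow> indicator (S - {a}) x * blinfun_apply (gateaux_differential norm (a - x)) u"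
    proof (cases "x = a")
      case False
      then have "has_gateaux_differential norm (gateaux_differential norm (a - x)) (a - x)"
        using smooth_space_gateaux_differential[OF smooth] by simp
      then have "((\<lambda>t. (norm (a - x + t *\<^sub>R u) - norm (a - x)) / t)
          \<longlongrightarrow> blinfun_apply (gateaux_differential norm (a - x)) u) (at_right 0)"
        unfolding has_gateaux_differential_def by (meson filterlim_at_split)
      from filterlim_compose[OF this inverse_Suc_at_right_0]
      have "(\<lambda>k. ?q k x) \<longlonglongrightarrow> blinfun_apply (gateaux_differential norm (a - x)) u"
        by (simp add: norm_minus_commute[of x] algebra_simps)
      then show ?thesis by (intro tendsto_intros)
    qed simp
  qed measurable
  have "(\<lambda>x. norm (x - a) powr (r - 1)
      * (indicator (S - {a}) x * blinfun_apply (gateaux_differential norm (a - x)) u)) \<in> borel_measurable \<mu>"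
    by (rule borel_measurable_times[OF _ directional]) measurable
  then show ?thesis
    unfolding loss_derivative_def[abs_def] by (simp add: mult_ac)
qed

text \<open>
  Dominated convergence along \<open>t = 1 / (k + 1)\<close> in the inequality for the perturbation \<open>c = a + t u\<close>.
\<close>

lemma optimal_one_sided_derivative:
  assumes opt: "optimal n \<alpha>" and smooth: "smooth_space TYPE('a)"
    and a: "a \<in> \<alpha>" and S: "selectable_cell \<alpha> a S"
    and r1: "r = 1 \<Longrightarrow> AE x in \<mu>. x \<noteq> a"
  shows "integrable \<mu> (loss_derivative a S u)" "0 \<le> (\<integral>x. loss_derivative a S u x \<partial>\<mu>)"
proof -
  have S_sets [measurable]: "S \<in> sets \<mu>" using S by (simp add: selectable_cell_def sets_eq_borel)
  define t where "t k = inverse (real (Suc k))" for k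
  have t: "0 < t k" "t k \<le> 1" for k by (auto simp: t_def field_simps)
  have t_lim: "filterlim t (at_right 0) sequentially"
    unfolding t_def[abs_def] by (rule inverse_Suc_at_right_0)
  let ?s = "\<lambda>k x. indicator S x * ((norm (x - (a + t k *\<^sub>R u)) powr r - norm (x - a) powr r) / t k)"
  let ?f = "\<lambda>x. r * loss_derivative a S u x"
  let ?w = "\<lambda>x. norm (x - (a + u)) powr r + norm (x - (a - u)) powr r + norm (x - a) powr r"
  have shift: "norm (x - (a + z)) = norm ((a - x) + z)" "norm (x - (a - z)) = norm ((a - x) - z)" for x z
    using norm_minus_commute[of x "a + z"] norm_minus_commute[of x "a - z"] by (simp_all add: algebra_simps)
  have quotient: "(norm (x - (a + h *\<^sub>R u)) powr r - norm (x - a) powr r) / h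
      = (norm ((a - x) + h *\<^sub>R u) powr r - norm (a - x) powr r) / h" for x h
    unfolding shift norm_minus_commute[of x a] ..
  have f_meas: "?f \<in> borel_measurable \<mu>"
    using measurable_loss_derivative[OF smooth S_sets] by measurable
  have s_meas: "?s k \<in> borel_measurable \<mu>" for k by measurable
  have w: "integrable \<mu> ?w"
    by (intro Bochner_Integration.integrable_add integrable_norm_diff_powr)
  have lim: "AE x in \<mu>. (\<lambda>k. ?s k x) \<longlonglongrightarrow> ?f x"
  proof -
    have ne_a: "(\<lambda>k. ?s k x) \<longlonglongrightarrow> ?f x" if "x \<noteq> a" for x
    proof -
      have D: "has_gateaux_differential norm (gateaux_differential norm (a - x)) (a - x)"
        using smooth_space_gateaux_differential[OF smooth] that by simp
      have "((\<lambda>h. (norm (x - (a + h *\<^sub>R u)) powr r - norm (x - a) powr r) / h)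
          \<longlongrightarrow> r * norm (a - x) powr (r - 1) * blinfun_apply (gateaux_differential norm (a - x)) u) (at_right 0)"
        unfolding quotient using norm_powr_difference_quotient_tendsto[OF D, of u r] that
        by (simp add: filterlim_at_split)
      from filterlim_compose[OF this t_lim] have
        "(\<lambda>k. ?s k x) \<longlonglongrightarrow> indicator S x * (r * norm (a - x) powr (r - 1) * blinfun_apply (gateaux_differential norm (a - x)) u)"
        by (intro tendsto_intros)
      moreover have "indicator S x * (r * norm (a - x) powr (r - 1) * blinfun_apply (gateaux_differential norm (a - x)) u) = ?f x"
        using that by (simp add: loss_derivative_def indicator_def norm_minus_commute[of x a])
      ultimately show ?thesis by (simp only:)
    qed
    show ?thesis
    proof (cases "r = 1")
      case True
      from r1[OF this] show ?thesis by eventually_elim (rule ne_a)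
    next
      case False
      have at_a: "(\<lambda>k. ?s k a) \<longlonglongrightarrow> ?f a"
      proof -
        have "(\<lambda>k. indicator S a * (norm (t k *\<^sub>R u) powr r / t k)) \<longlonglongrightarrow> indicator S a * 0"
          using filterlim_compose[OF norm_powr_difference_quotient_tendsto_0 t_lim, of r u] False r_ge_1
          by (intro tendsto_intros) simp
        then show ?thesis by (simp add: loss_derivative_def)
      qed
      show ?thesis
      proof (rule AE_I2)
        fix x show "(\<lambda>k. ?s k x) \<longlonglongrightarrow> ?f x"
        proof (cases "x = a")
          case True then show ?thesis by (simp only: at_a)
        next
          case False then show ?thesis by (rule ne_a)
        qed
      qed
    qed
  qed
  have bound: "AE x in \<mu>. norm (?s k x) \<le> ?w x" for k
  proof (rule AE_I2)
    fix x
    have "\<bar>(norm (x - (a + t k *\<^sub>R u)) powr r - norm (x - a) powr r) / t k\<bar> \<le> ?w x"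
      unfolding quotient shift norm_minus_commute[of x a]
      by (rule norm_powr_difference_quotient_bound[OF r_ge_1 t])
    moreover have "0 \<le> ?w x" by (intro add_nonneg_nonneg powr_ge_zero)
    ultimately show "norm (?s k x) \<le> ?w x"
      by (cases "x \<in> S") (simp_all only: indicator_simps simp_thms mult_1 mult_zero_left real_norm_def abs_zero)
  qed
  have "integrable \<mu> ?f"
    by (rule integrable_dominated_convergence[OF f_meas s_meas w lim bound])
  then show "integrable \<mu> (loss_derivative a S u)" using r_ge_1 by simp
  have "0 \<le> (\<integral>x. ?s k x \<partial>\<mu>)" for k
  proof -
    have "(\<integral>x. ?s k x \<partial>\<mu>) = (\<integral>x. indicator S x * (norm (x - (a + t k *\<^sub>R u)) powr r - norm (x - a) powr r) / t k \<partial>\<mu>)"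
      unfolding times_divide_eq_right ..
    also have "\<dots> = (\<integral>x. indicator S x * (norm (x - (a + t k *\<^sub>R u)) powr r - norm (x - a) powr r) \<partial>\<mu>) / t k"
      by (rule integral_divide_zero)
    finally show ?thesis
      using divide_nonneg_pos[OF optimal_perturbation[OF opt a S] t(1)] by (simp only:)
  qed
  then have "0 \<le> (\<integral>x. ?f x \<partial>\<mu>)"
    by (intro LIMSEQ_le_const[OF integral_dominated_convergence[OF f_meas s_meas w lim bound]]) auto
  then show "0 \<le> (\<integral>x. loss_derivative a S u x \<partial>\<mu>)"
    using r_ge_1 by (simp add: zero_le_mult_iff)
qed

lemma optimal_first_order_condition:
  assumes "optimal n \<alpha>" "smooth_space TYPE('a)" "a \<in> \<alpha>" "selectable_cell \<alpha> a S"
    and "r = 1 \<Longrightarrow> AE x in \<mu>. x \<noteq> a"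
  shows "has_bochner_integral \<mu> (loss_derivative a S u) 0"
proof -
  note nonneg = optimal_one_sided_derivative[OF assms]
  have "loss_derivative a S (- u) = (\<lambda>x. - loss_derivative a S u x)"
    by (simp add: loss_derivative_def fun_eq_iff blinfun.minus_right)
  then have "(\<integral>x. loss_derivative a S u x \<partial>\<mu>) = 0"
    using nonneg(2)[of u] nonneg(2)[of "- u"] by simp
  then show ?thesis
    using nonneg(1)[of u] by (simp add: has_bochner_integral_iff)
qed

text \<open>
  The first-order conditions for the full cell of \<open>a\<close> and for that cell without the cell of \<open>b\<close>
  differ by an integral over the overlap, whose integrand has strict sign in direction \<open>b - a\<close>.
\<close>

lemma optimal_cell_overlap_null:
  assumes opt: "optimal n \<alpha>" and smooth: "smooth_space TYPE('a)" and sc: "strictly_convex_space TYPE('a)"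
    and ab: "a \<in> \<alpha>" "b \<in> \<alpha>" "a \<noteq> b"
    and r1: "r = 1 \<Longrightarrow> AE x in \<mu>. x \<noteq> a"
  shows "measure \<mu> (voronoi_cell \<alpha> a \<inter> voronoi_cell \<alpha> b) = 0"
proof -
  note fin = optimal_finite(1)[OF opt]
  let ?V = "voronoi_cell \<alpha> a" and ?W = "voronoi_cell \<alpha> b"
  let ?f = "\<lambda>x. - loss_derivative a (?V \<inter> ?W) (b - a) x"
  have f_eq: "?f x = loss_derivative a (?V - ?W) (b - a) x - loss_derivative a ?V (b - a) x" for x
    by (simp add: loss_derivative_def indicator_def)
  have "has_bochner_integral \<mu> (\<lambda>x. loss_derivative a (?V - ?W) (b - a) x - loss_derivative a ?V (b - a) x) (0 - 0)"
    by (intro has_bochner_integral_diff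
        optimal_first_order_condition[OF opt smooth ab(1) selectable_cell_minus[OF fin ab] r1]
        optimal_first_order_condition[OF opt smooth ab(1) selectable_cell_voronoi_cell[OF fin ab(1)] r1])
  then have int: "integrable \<mu> ?f" and zero: "(\<integral>x. ?f x \<partial>\<mu>) = 0"
    unfolding f_eq by (auto simp: has_bochner_integral_iff)
  have pos: "0 < ?f x" if x: "x \<in> ?V \<inter> ?W" for x
  proof -
    have eq: "norm (a - x) = norm (b - x)"
      using x ab voronoi_cell_iff[OF fin] by (metis IntD1 IntD2 antisym norm_minus_commute)
    then have "x \<noteq> a" using ab by auto
    then have "has_gateaux_differential norm (gateaux_differential norm (a - x)) (a - x)"
      using smooth_space_gateaux_differential[OF smooth] by simp
    from gateaux_differential_strictly_convex_neg[OF sc this eq] ab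
    have "blinfun_apply (gateaux_differential norm (a - x)) (b - a) < 0" by simp
    moreover have "0 < norm (x - a) powr (r - 1)" using \<open>x \<noteq> a\<close> by simp
    ultimately show ?thesis
      using x \<open>x \<noteq> a\<close> by (simp add: loss_derivative_def mult_pos_neg)
  qed
  have "0 \<le> ?f x" for x
    using pos[of x] by (cases "x \<in> ?V \<inter> ?W") (auto simp: loss_derivative_def)
  then have "AE x in \<mu>. ?f x = 0"
    using integral_nonneg_eq_0_iff_AE[OF int] zero by simp
  then have "AE x in \<mu>. x \<notin> ?V \<inter> ?W"
    by eventually_elim (use pos in force)
  moreover have "?V \<inter> ?W \<in> sets \<mu>"
    using closed_voronoi_cell[OF fin] ab by (auto simp: sets_eq_borel)
  ultimately show ?thesis
    by (simp add: AE_iff_measurable[OF _ refl] measure_eq_0_null_sets AE_iff_null_sets)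
qed

end

section \<open>Optimal quantizers of a random variable\<close>

lemma finite_moment_distribution_distr:
  fixes X :: "'w \<Rightarrow> 'a::real_normed_vector"
  assumes M: "prob_space M" and X: "X \<in> borel_measurable M"
    and r: "1 \<le> r" and int: "integrable M (\<lambda>w. norm (X w) powr r)"
  shows "finite_moment_distribution (distr M borel X) r"
proof (intro finite_moment_distribution.intro finite_moment_distribution_axioms.intro)
  show "prob_space (distr M borel X)"
    by (rule prob_space.prob_space_distr[OF M X])
  have "(norm :: 'a \<Rightarrow> real) \<in> borel_measurable borel"
    by (intro borel_measurable_continuous_onI continuous_intros)
  then have "(\<lambda>x::'a. norm x powr r) \<in> borel_measurable borel"
    by measurable
  then show "integrable (distr M borel X) (\<lambda>x. norm x powr r)"
    using int integrable_distr_eq[OF X] by blast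
qed (simp_all add: r)

lemma optimal_quantizer_stationary_admissible:
  fixes X :: "'w \<Rightarrow> 'a::real_normed_vector"
  assumes smooth: "smooth_space TYPE('a)" and sc: "strictly_convex_space TYPE('a)"
    and M: "prob_space M" and X [measurable]: "X \<in> borel_measurable M"
    and r: "1 \<le> r" and int: "integrable M (\<lambda>w. norm (X w) powr r)"
    and supp: "finite (msupport (distr M borel X)) \<longrightarrow> n \<le> card (msupport (distr M borel X))"
    and opt: "optimal_quantizer M X r n \<alpha>"
    and r1: "r = 1 \<Longrightarrow> measure (distr M borel X) \<alpha> = 0"
  shows "stationary M X r n \<alpha>" "admissible M X n \<alpha>"
proof -
  let ?\<mu> = "distr M borel X"
  interpret finite_moment_distribution ?\<mu> r
    by (rule finite_moment_distribution_distr[OF M X r int])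
  have error: "quant_error M X r \<beta> = ennreal (\<integral>x. quant_loss r \<beta> x \<partial>?\<mu>)"
    if "\<beta> \<in> quantizers n" for \<beta>
  proof -
    have \<beta>: "finite \<beta>" "\<beta> \<noteq> {}" using that by (auto simp: quantizers_def)
    have "quant_error M X r \<beta> = (\<integral>\<^sup>+x. ennreal (quant_loss r \<beta> x) \<partial>?\<mu>)"
      unfolding quant_error_def quant_loss_def[symmetric] using measurable_quant_loss[OF \<beta>(1)]
      by (subst nn_integral_distr[OF X]) simp_all
    also have "\<dots> = ennreal (\<integral>x. quant_loss r \<beta> x \<partial>?\<mu>)"
    proof (rule nn_integral_eq_integral[OF integrable_quant_loss[OF \<beta>]], rule AE_I2)
      fix x show "0 \<le> quant_loss r \<beta> x"
        by (rule quant_loss_attained[OF \<beta>, of r x]) simp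
    qed
    finally show ?thesis .
  qed
  have \<alpha>: "\<alpha> \<in> quantizers n" using opt by (simp add: optimal_quantizer_def)
  have opt': "optimal n \<alpha>"
    unfolding optimal_def
  proof (intro conjI ballI \<alpha>)
    fix \<beta> :: "'a set" assume \<beta>: "\<beta> \<in> quantizers n"
    have "quant_error M X r \<alpha> \<le> quant_error M X r \<beta>"
      using opt \<beta> unfolding optimal_quantizer_def by (auto intro: INF_lower)
    moreover have "0 \<le> (\<integral>x. quant_loss r \<beta> x \<partial>?\<mu>)"
    proof (rule Bochner_Integration.integral_nonneg)
      fix x show "0 \<le> quant_loss r \<beta> x"
        by (rule quant_loss_attained[of \<beta> r x]) (use \<beta> in \<open>auto simp: quantizers_def\<close>)
    qed
    ultimately show "(\<integral>x. quant_loss r \<alpha> x \<partial>?\<mu>) \<le> (\<integral>x. quant_loss r \<beta> x \<partial>?\<mu>)"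
      using error[OF \<alpha>] error[OF \<beta>] by simp
  qed
  note fin = optimal_finite(1)[OF opt']
  note card = optimal_card[OF opt' supp]
  have r1': "AE x in ?\<mu>. x \<noteq> a" if "a \<in> \<alpha>" "r = 1" for a
  proof -
    have "\<alpha> \<in> sets ?\<mu>" using finite_imp_closed[OF fin] by simp
    then have "\<alpha> \<in> null_sets ?\<mu>"
      using r1[OF that(2)] by (simp add: null_sets_def emeasure_eq_measure)
    from AE_not_in[OF this] show ?thesis by eventually_elim (use that in auto)
  qed
  show "admissible M X n \<alpha>"
    unfolding admissible_def
  proof (intro conjI ballI impI fin card)
    fix a assume a: "a \<in> \<alpha>"
    show "measure ?\<mu> (voronoi_cell \<alpha> a) > 0"
      by (rule optimal_cell_not_null[OF opt' supp a selectable_cell_voronoi_cell[OF fin a]])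
    fix b assume "b \<in> \<alpha>" "a \<noteq> b"
    then show "measure ?\<mu> (voronoi_cell \<alpha> a \<inter> voronoi_cell \<alpha> b) = 0"
      by (rule optimal_cell_overlap_null[OF opt' smooth sc a _ _ r1'[OF a]])
  qed
  show "stationary M X r n \<alpha>"
    unfolding stationary_def
  proof (intro conjI allI impI ballI fin card)
    fix C a assume C: "voronoi_partition \<alpha> C" and a: "a \<in> \<alpha>"
    note S = selectable_cell_voronoi_partition[OF C a]
    show "measure ?\<mu> (C a) > 0"
      by (rule optimal_cell_not_null[OF opt' supp a S])
    show "AE x in ?\<mu>. x \<in> C a - {a} \<longrightarrow> gateaux_differentiable norm (a - x)"
      using smooth by (intro AE_I2) (auto simp: smooth_space_def)
    show "has_weak_expectation M (\<lambda>w. (indicator (C a - {a}) (X w) * norm (X w - a) powr (r - 1))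
                *\<^sub>R gateaux_differential norm (a - X w)) 0"
      unfolding has_weak_expectation_def
    proof
      fix u
      have meas: "loss_derivative a (C a) u \<in> borel_measurable borel"
        using measurable_loss_derivative[OF smooth, of "C a" a u] S by (simp add: selectable_cell_def)
      have "has_bochner_integral ?\<mu> (loss_derivative a (C a) u) 0"
        by (rule optimal_first_order_condition[OF opt' smooth a S r1'[OF a]])
      then have "has_bochner_integral M (\<lambda>w. loss_derivative a (C a) u (X w)) 0"
        unfolding has_bochner_integral_iff integrable_distr_eq[OF X meas] integral_distr[OF X meas] .
      then show "has_bochner_integral M (\<lambda>w. blinfun_apply ((indicator (C a - {a}) (X w) * norm (X w - a) powr (r - 1))
                *\<^sub>R gateaux_differential norm (a - X w)) u) (blinfun_apply 0 u)"
        unfolding loss_derivative_def scaleR_blinfun.rep_eq zero_blinfun.rep_eq real_scaleR_def .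
    qed
  qed (use r1 in auto)
qed

theorem proposition7:
  fixes M :: "'w measure" and X :: "'w \<Rightarrow> 'a::banach" and n :: nat and r :: real
  assumes "smooth_space TYPE('a)" and "strictly_convex_space TYPE('a)"
    and "prob_space M" and "radon_rv M X"
    and "1 \<le> n" and "1 \<le> r"
    and "integrable M (\<lambda>w. norm (X w) powr r)"
    and "finite (msupport (distr M borel X)) \<longrightarrow> n \<le> card (msupport (distr M borel X))"
  shows "(1 < r \<longrightarrow> (\<forall>\<alpha>. optimal_quantizer M X r n \<alpha> \<longrightarrow>
            stationary M X r n \<alpha> \<and> admissible M X n \<alpha>)) \<and>
         (r = 1 \<longrightarrow> (\<forall>\<alpha>. optimal_quantizer M X r n \<alpha> \<longrightarrow> measure (distr M borel X) \<alpha> = 0 \<longrightarrow>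
            stationary M X r n \<alpha> \<and> admissible M X n \<alpha>))"
  using assms optimal_quantizer_stationary_admissible[of M X r n]
  unfolding radon_rv_def by auto

end
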